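(* Let $n$ be an even positive integer, $k\ge 2$, and let $B_j\in\mathbb{R}^{[j,n]}$, $j=2,\dots,k$, be supersymmetric tensors. Consider the Hamiltonian system on $\mathbb{R}^n$ $$\dot{x}=kJB_kx^{k-1}+(k-1)JB_{k-1}x^{k-2}+\cdots+2JB_2x .$$ Let $x^*\neq 0$ be an equilibrium of this system. If the matrix $$k(k-1)B_k(x^* )^{k-2}+(k-1)(k-2)B_{k-1}(x^* )^{k-3}+\cdots+2B_2$$ is positive definite or negative definite, then $x^*$ is (Lyapunov) stable.
   Context: $\mathbb{R}^{[k,n]}$ denotes the set of real cubical tensors of order $k$ and dimension $n$, i.e. arrays $(A_{i_1\ldots i_k})$ with $1\le i_1,\dots,i_k\le n$. A tensor is supersymmetric if its entries are invariant under every permutation of the indices. For $A\in\mathbb{R}^{[k,n]}$ and $x\in\mathbb{R}^n$, $Ax^{k-1}\in\mathbb{R}^n$ is the vector with entries $(Ax^{k-1})_{i_1}=\sum_{i_2,\ldots,i_k=1}^n A_{i_1i_2\ldots i_k}x_{i_2}\cdots x_{i_k}$, and $Ax^{k-2}\in\mathbb{R}^{n\times n}$ is the matrix with entries $(Ax^{k-2})_{i_1i_2}=\sum_{i_3,\ldots,i_k=1}^nA_{i_1i_2i_3\ldots i_k}x_{i_3}\cdots x_{i_k}$ (equal to $A$ itself when $k=2$). For a matrix $R\in\mathbb{R}^{n\times n}$, the product $RA\in\mathbb{R}^{[k,n]}$ is $(RA)_{i_1i_2\ldots i_k}=\sum_{j=1}^nR_{i_1j}A_{ji_2\ldots i_k}$.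 For even $n=2m$, $J=\begin{pmatrix}0&I_m\\-I_m&0\end{pmatrix}\in\mathbb{R}^{n\times n}$. The system is $\dot x=J\,\partial H/\partial x$ with $H(x)=\sum_{j=2}^kB_jx^j$, where $B_jx^j=\sum_{i_1,\ldots,i_j=1}^n(B_j)_{i_1\ldots i_j}x_{i_1}\cdots x_{i_j}$. The displayed matrix is $\sum_{j=2}^kj(j-1)B_j(x^* )^{j-2}$. *)

theory Defs
  imports "HOL-Analysis.Analysis" "HOL-Combinatorics.Permutations"
begin

text \<open>
  A tensor of order \<open>k\<close> and dimension \<open>CARD('n)\<close> is a function on index lists over \<open>'n\<close>. Only its
  values on lists of length \<open>k\<close> are relevant, and the order is passed explicitly where it is needed.
\<close>

type_synonym 'n tensor = "'n list \<Rightarrow> real"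

definition supersymmetric :: "nat \<Rightarrow> 'n tensor \<Rightarrow> bool" where
  "supersymmetric k A \<longleftrightarrow>
     (\<forall>js p. length js = k \<longrightarrow> p permutes {..<k} \<longrightarrow> A (permute_list p js) = A js)"

text \<open>
  For \<open>A\<close> of order \<open>k\<close>, \<open>tensor_vec k A x\<close> is $A x^{k-1}$ and \<open>tensor_mat k A x\<close> is $A x^{k-2}$.
\<close>

definition tensor_vec :: "nat \<Rightarrow> 'n::finite tensor \<Rightarrow> real ^ 'n \<Rightarrow> real ^ 'n" where
  "tensor_vec k A x =
     (\<chi> i. \<Sum>js | length js = k - 1. A (i # js) * prod_list (map (\<lambda>j. x $ j) js))"

definition tensor_mat :: "nat \<Rightarrow> 'n::finite tensor \<Rightarrow> real ^ 'n \<Rightarrow> real ^ 'n ^ 'n" where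
  "tensor_mat k A x =
     (\<chi> i1 i2. \<Sum>js | length js = k - 2. A (i1 # i2 # js) * prod_list (map (\<lambda>j. x $ j) js))"

text \<open>The product $RA$ of a matrix and a tensor of positive order; the value on \<open>[]\<close> is a dummy.\<close>

definition matrix_tensor :: "real ^ 'n ^ 'n \<Rightarrow> 'n::finite tensor \<Rightarrow> 'n tensor" where
  "matrix_tensor R A js =
     (case js of [] \<Rightarrow> 0 | i # is' \<Rightarrow> \<Sum>j\<in>UNIV. R $ i $ j * A (j # is'))"

text \<open>
  Dimension $n = 2m$ is rendered by the index type \<open>'m + 'm\<close> with $m$ = \<open>CARD('m)\<close>: \<open>Inl\<close> indexes the
  first $m$ coordinates, \<open>Inr\<close> the last $m$.
\<close>

definition symplectic_J :: "real ^ ('m::finite + 'm) ^ ('m + 'm)" where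
  "symplectic_J = (\<chi> i j. case (i, j) of
       (Inl a, Inr b) \<Rightarrow> if a = b then 1 else 0
     | (Inr a, Inl b) \<Rightarrow> if a = b then - 1 else 0
     | _ \<Rightarrow> 0)"

definition hamiltonian_field ::
  "nat \<Rightarrow> (nat \<Rightarrow> ('m::finite + 'm) tensor) \<Rightarrow> real ^ ('m + 'm) \<Rightarrow> real ^ ('m + 'm)" where
  "hamiltonian_field k B x =
     (\<Sum>j = 2..k. real j *\<^sub>R tensor_vec j (matrix_tensor symplectic_J (B j)) x)"

text \<open>Symmetry is not part of these notions.\<close>

definition positive_definite :: "real ^ 'n ^ 'n \<Rightarrow> bool" where
  "positive_definite M \<longleftrightarrow> (\<forall>v. v \<noteq> 0 \<longrightarrow> v \<bullet> (M *v v) > 0)"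

definition negative_definite :: "real ^ 'n ^ 'n \<Rightarrow> bool" where
  "negative_definite M \<longleftrightarrow> (\<forall>v. v \<noteq> 0 \<longrightarrow> v \<bullet> (M *v v) < 0)"

definition solution_on ::
  "('a::real_normed_vector \<Rightarrow> 'a) \<Rightarrow> (real \<Rightarrow> 'a) \<Rightarrow> real set \<Rightarrow> bool" where
  "solution_on f x I \<longleftrightarrow> (\<forall>t\<in>I. (x has_vector_derivative f (x t)) (at t within I))"

definition equilibrium :: "('a::real_normed_vector \<Rightarrow> 'a) \<Rightarrow> 'a \<Rightarrow> bool" where
  "equilibrium f p \<longleftrightarrow> f p = 0"

text \<open>
  Solutions starting near \<open>p\<close> exist for all forward time and stay near \<open>p\<close>. Quantifying over local
  solutions as well avoids any appeal to uniqueness or to maximal intervals of existence.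
\<close>

definition lyapunov_stable :: "('a::real_normed_vector \<Rightarrow> 'a) \<Rightarrow> 'a \<Rightarrow> bool" where
  "lyapunov_stable f p \<longleftrightarrow>
     (\<forall>\<epsilon>>0. \<exists>\<delta>>0. \<forall>x0. dist x0 p < \<delta> \<longrightarrow>
        (\<exists>x. solution_on f x {0..} \<and> x 0 = x0) \<and>
        (\<forall>x T. T > 0 \<longrightarrow> solution_on f x {0..<T} \<longrightarrow> x 0 = x0 \<longrightarrow>
           (\<forall>t\<in>{0..<T}. dist (x t) p < \<epsilon>)))"

end

theory Submission
  imports Defs
begin

text \<open>
  The vector field is \<open>J \<nabla>H\<close> with \<open>\<nabla>H\<close> vanishing exactly at the equilibria, and the displayed matrix is the
  Hessian of \<open>H\<close> at \<open>x*\<close>. Definiteness makes \<open>\<plusminus>H\<close> a conserved quantity with a strict local minimum at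
  \<open>x*\<close>; a solution that starts below the minimum of \<open>\<plusminus>H\<close> over a small sphere cannot cross that sphere.
  For global existence, the field is composed with the nearest-point projection onto a ball, which makes
  it globally Lipschitz; solutions of the modified equation are confined to the ball, where both fields agree.
\<close>

section \<open>Global solutions of globally Lipschitz equations\<close>

text \<open>Near \<open>t\<close> the half-line coincides with \<open>{a..t + 1}\<close>, so the
  version for compact intervals applies; at \<open>t = a\<close> the derivative is
  one-sided.\<close>

lemma indefinite_integral_has_vector_derivative:
  fixes h :: "real \<Rightarrow> 'a::banach"
  assumes "continuous_on {a..} h" "a \<le> t"
  shows "((\<lambda>u. integral {a..u} h) has_vector_derivative h t) (at t within {a..})"
proof -
  have "((\<lambda>u. integral {a..u} h) has_vector_derivative h t) (at t within {a..t + 1})"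
    using assms by (intro integral_has_vector_derivative) (auto intro: continuous_on_subset)
  moreover have "at t within {a..} = at t within {a..t + 1}"
    by (rule at_within_nhd[of t "{..<t + 1}"]) auto
  ultimately show ?thesis by simp
qed

text \<open>Integrating the exponential yields the factor \<open>1 / c\<close>. This gain is what
  makes the weighted Picard operator contract when \<open>c\<close> is large.\<close>

lemma norm_integral_exp_bound:
  fixes h :: "real \<Rightarrow> 'a::banach"
  assumes h: "continuous_on {0..} h" and le: "\<And>s. 0 \<le> s \<Longrightarrow> norm (h s) \<le> C * exp (c * s)"
    and "c > 0" "0 \<le> t"
  shows "norm (integral {0..t} h) \<le> C / c * exp (c * t)"
proof -
  have "C \<ge> 0"
    using order_trans[OF norm_ge_zero le[of 0]] by simp
  have int: "((\<lambda>s. C * exp (c * s)) has_integral C / c * exp (c * t) - C / c * exp (c * 0)) {0..t}"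
    using \<open>c > 0\<close> \<open>0 \<le> t\<close>
    by (intro fundamental_theorem_of_calculus)
       (auto intro!: derivative_eq_intros simp flip: has_real_derivative_iff_has_vector_derivative)
  have "norm (integral {0..t} h) \<le> integral {0..t} (\<lambda>s. C * exp (c * s))"
    using le \<open>0 \<le> t\<close>
    by (intro integral_norm_bound_integral integrable_continuous_real continuous_on_subset[OF h]
        continuous_intros) auto
  also have "\<dots> = C / c * exp (c * t) - C / c"
    using integral_unique[OF int] by simp
  finally show ?thesis
    using \<open>C \<ge> 0\<close> \<open>c > 0\<close> by (smt (verit) divide_nonneg_pos)
qed

text \<open>
  The Picard operator is a contraction for the weighted norm \<open>sup\<^sub>t exp (- 2 (L + 1) t) \<parallel>y t\<parallel>\<close> on the whole
  half-line, so no continuation of local solutions is needed.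
\<close>

theorem global_solution_exists:
  fixes F :: "'a::banach \<Rightarrow> 'a"
  assumes "L-lipschitz_on UNIV F"
  obtains y where "solution_on F y {0..}" "y 0 = x0"
proof -
  \<comment> \<open>One is added so that the constant is positive even for \<open>L = 0\<close> and
    can be divided by.\<close>
  define M where "M = L + 1"
  have M: "M > 0" "M-lipschitz_on UNIV F"
    using lipschitz_on_nonneg[OF assms] lipschitz_on_mono[OF assms, of UNIV M] by (auto simp: M_def)
  have contF: "continuous_on UNIV F"
    using M(2) lipschitz_on_continuous_on by blast
  \<comment> \<open>The weighted Picard operator has Lipschitz constant \<open>M / c\<close>, which
    is 1/2 for this \<open>c\<close>.\<close>
  define c where "c = 2 * M"
  have c: "c > 0" using M by (simp add: c_def)
  \<comment> \<open>The unknown \<open>z\<close> is the solution multiplied by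
    \<open>exp (- c * t)\<close>; \<open>h z\<close> is \<open>F\<close> along the unweighted
    curve.\<close>
  define h where "h z s = F (exp (c * s) *\<^sub>R apply_bcontfun z s)" for z :: "real \<Rightarrow>\<^sub>C 'a" and s
  \<comment> \<open>The elements of \<open>\<Rightarrow>\<^sub>C\<close> are defined on the whole
    line; \<open>max 0 t\<close> extends the image to negative times by the constant
    \<open>x0\<close>.\<close>
  define \<Phi>' where "\<Phi>' z t = exp (- c * max 0 t) *\<^sub>R (x0 + integral {0..max 0 t} (h z))"
    for z and t :: real
  have conth: "continuous_on S (h z)" for z S
    unfolding h_def by (intro continuous_intros continuous_on_compose2[OF contF]) auto
  have contI: "continuous_on {0..} (\<lambda>u. integral {0..u} (h z))" for z
    using indefinite_integral_has_vector_derivative[OF conth]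
    by (fastforce simp: continuous_on_eq_continuous_within intro: has_vector_derivative_continuous)
  have "continuous_on UNIV (\<lambda>t::real. integral {0..max 0 t} (h z))" for z
    by (rule continuous_on_compose2[OF contI]) (auto intro: continuous_intros)
  then have cont\<Phi>: "continuous_on UNIV (\<Phi>' z)" for z
    unfolding \<Phi>'_def by (intro continuous_intros)
  have weight: "exp (- c * u) * (C * exp (c * u)) = C" for C u
    by (simp add: exp_minus field_simps)
  \<comment> \<open>The image stays bounded because \<open>F\<close> grows at most linearly, by
    comparison with \<open>F 0\<close>; the weight absorbs the growth of the integral.\<close>
  have bound: "norm (\<Phi>' z t) \<le> norm x0 + (norm (F 0) + M * norm z) / c" for z t
  proof -
    define u where "u = max 0 t"
    have u: "u \<ge> 0" by (simp add: u_def)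
    have "norm (h z s) \<le> (norm (F 0) + M * norm z) * exp (c * s)" if "0 \<le> s" for s
    proof -
      have "norm (h z s - F 0) \<le> M * norm (exp (c * s) *\<^sub>R apply_bcontfun z s)"
        using lipschitz_on_normD[OF M(2) UNIV_I UNIV_I, of "exp (c * s) *\<^sub>R apply_bcontfun z s" 0]
        by (simp only: h_def diff_0_right)
      also have "\<dots> \<le> M * (exp (c * s) * norm z)"
        using norm_bounded[of z s] M(1) by simp
      finally have "norm (h z s - F 0) \<le> M * norm z * exp (c * s)"
        by (simp add: mult_ac)
      moreover have "norm (F 0) * 1 \<le> norm (F 0) * exp (c * s)"
        using c that by (intro mult_left_mono) auto
      ultimately show ?thesis
        using norm_triangle_ineq[of "F 0" "h z s - F 0"] by (simp add: distrib_right)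
    qed
    then have "norm (integral {0..u} (h z)) \<le> (norm (F 0) + M * norm z) / c * exp (c * u)"
      by (intro norm_integral_exp_bound conth c u)
    then have "exp (- c * u) * norm (integral {0..u} (h z))
        \<le> exp (- c * u) * ((norm (F 0) + M * norm z) / c * exp (c * u))"
      by (intro mult_left_mono) auto
    also have "\<dots> = (norm (F 0) + M * norm z) / c"
      by (rule weight)
    finally have 1: "exp (- c * u) * norm (integral {0..u} (h z)) \<le> (norm (F 0) + M * norm z) / c" .
    have "norm (\<Phi>' z t) = exp (- c * u) * norm (x0 + integral {0..u} (h z))"
      by (simp add: \<Phi>'_def u_def)
    also have "\<dots> \<le> exp (- c * u) * (norm x0 + norm (integral {0..u} (h z)))"
      by (intro mult_left_mono norm_triangle_ineq) auto
    finally have "norm (\<Phi>' z t)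
        \<le> exp (- c * u) * norm x0 + exp (- c * u) * norm (integral {0..u} (h z))"
      by (simp add: distrib_left)
    moreover have "exp (- c * u) * norm x0 \<le> norm x0"
      using c u by (simp add: mult_left_le_one_le)
    ultimately show ?thesis using 1 by linarith
  qed
  define \<Phi> where "\<Phi> z = Bcontfun (\<Phi>' z)" for z
  have \<Phi>: "apply_bcontfun (\<Phi> z) = \<Phi>' z" for z
    unfolding \<Phi>_def by (rule Bcontfun_inverse[OF bcontfun_normI[OF cont\<Phi> bound]])
  have contr: "dist (\<Phi> z) (\<Phi> w) \<le> 1 / 2 * dist z w" for z w
  proof (rule dist_bound)
    fix t :: real
    define u where "u = max 0 t"
    have u: "u \<ge> 0" by (simp add: u_def)
    have "norm (h z s - h w s) \<le> M * dist z w * exp (c * s)" for s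
    proof -
      have "norm (h z s - h w s)
          \<le> M * norm (exp (c * s) *\<^sub>R (apply_bcontfun z s - apply_bcontfun w s))"
        unfolding scaleR_diff_right h_def using lipschitz_on_normD[OF M(2)] by blast
      also have "\<dots> \<le> M * (exp (c * s) * dist z w)"
        using dist_bounded[of z s w] M(1) by (simp add: dist_norm)
      finally show ?thesis by (simp add: mult_ac)
    qed
    then have "norm (integral {0..u} (\<lambda>s. h z s - h w s)) \<le> M * dist z w / c * exp (c * u)"
      by (intro norm_integral_exp_bound continuous_intros conth c u)
    then have "exp (- c * u) * norm (integral {0..u} (\<lambda>s. h z s - h w s))
        \<le> exp (- c * u) * (M * dist z w / c * exp (c * u))"
      by (intro mult_left_mono) auto
    also have "\<dots> = 1 / 2 * dist z w"
      using M(1) by (simp only: weight) (simp add: c_def)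
    also have "integral {0..u} (\<lambda>s. h z s - h w s) = integral {0..u} (h z) - integral {0..u} (h w)"
      by (intro integral_diff integrable_continuous_real conth)
    finally have "norm (exp (- c * u) *\<^sub>R (integral {0..u} (h z) - integral {0..u} (h w)))
        \<le> 1 / 2 * dist z w"
      by simp
    then show "dist (apply_bcontfun (\<Phi> z) t) (apply_bcontfun (\<Phi> w) t) \<le> 1 / 2 * dist z w"
      by (simp add: \<Phi> \<Phi>'_def dist_norm u_def algebra_simps)
  qed
  then obtain z where z: "\<Phi> z = z"
    using banach_fix_type[of "1 / 2" \<Phi>] by auto
  \<comment> \<open>Undoing the weight turns the fixed-point equation into the integral equation for
    \<open>y\<close>.\<close>
  define y where "y t = exp (c * t) *\<^sub>R apply_bcontfun z t" for t
  have y: "y t = x0 + integral {0..t} (h z)" if "t \<ge> 0" for t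
  proof -
    have "y t = exp (c * t) *\<^sub>R \<Phi>' z t"
      by (simp add: y_def z flip: \<Phi>)
    also have "\<dots> = x0 + integral {0..t} (h z)"
      using that by (simp add: \<Phi>'_def flip: exp_add)
    finally show ?thesis .
  qed
  have "(y has_vector_derivative F (y t)) (at t within {0..})" if "t \<ge> 0" for t
  proof (rule has_vector_derivative_transform)
    show "((\<lambda>t. x0 + integral {0..t} (h z)) has_vector_derivative F (y t)) (at t within {0..})"
      using indefinite_integral_has_vector_derivative[OF conth that, of z]
      by (auto simp: h_def y_def intro: derivative_eq_intros)
  qed (use that y in auto)
  then have "solution_on F y {0..}"
    by (simp add: solution_on_def)
  moreover have "y 0 = x0"
    using y[of 0] by simp
  ultimately show thesis by (rule that)
qed

section \<open>Lyapunov stability from a conserved quantity\<close>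

text \<open>Up to the first contact with the sphere the curve lies in the closed ball, so
  \<open>V\<close> keeps its initial value until then, which is too small for a point of the sphere.
  Conservation is assumed on the ball alone so that a field altered outside it is covered
  too.\<close>

lemma conserved_quantity_confines:
  fixes f :: "'a::euclidean_space \<Rightarrow> 'a" and V :: "'a \<Rightarrow> real"
  assumes dV: "\<And>x. (V has_derivative V' x) (at x)"
    and cons: "\<And>x. x \<in> cball p \<epsilon> \<Longrightarrow> V' x (f x) = 0"
    and sphere: "\<And>x. dist x p = \<epsilon> \<Longrightarrow> V (y 0) < V x"
    and y: "solution_on f y {0..<T}" and y0: "dist (y 0) p < \<epsilon>" and t: "t \<in> {0..<T}"
  shows "dist (y t) p < \<epsilon>"
proof (rule ccontr)
  assume out: "\<not> dist (y t) p < \<epsilon>"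
  have conty: "continuous_on S y" if "S \<subseteq> {0..<T}" for S
    using y that
    by (meson continuous_on_subset continuous_on_eq_continuous_within has_vector_derivative_continuous
        solution_on_def)
  define d where "d s = dist (y s) p" for s
  have contd: "continuous_on S d" if "S \<subseteq> {0..<T}" for S
    unfolding d_def by (intro continuous_intros conty that)
  \<comment> \<open>The times of contact with the sphere; compactness provides a first one.\<close>
  define S where "S = {0..t} \<inter> d -` {\<epsilon>}"
  have "closed S"
    unfolding S_def using t by (intro continuous_closed_preimage contd) auto
  moreover have "bounded S"
    unfolding S_def by (meson bounded_Int bounded_closed_interval)
  ultimately have "compact S"
    by (simp add: compact_eq_bounded_closed)
  moreover have "S \<noteq> {}"
  proof -
    have "continuous_on {0..t} d"
      using t by (intro contd) auto
    then obtain q where "0 \<le> q" "q \<le> t" "d q = \<epsilon>"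
      using IVT'[of d 0 \<epsilon> t] y0 out t by (auto simp: d_def)
    then show ?thesis by (auto simp: S_def)
  qed
  ultimately obtain s where s: "s \<in> S" and least: "\<And>r. r \<in> S \<Longrightarrow> s \<le> r"
    by (meson compact_attains_inf)
  have st: "0 \<le> s" "s \<le> t" "d s = \<epsilon>"
    using s by (auto simp: S_def)
  \<comment> \<open>A point outside the ball at time \<open>r\<close> would force a contact strictly
    before \<open>r\<close>, hence before the first contact \<open>s\<close>.\<close>
  have inside: "y r \<in> cball p \<epsilon>" if r: "r \<in> {0..s}" for r
  proof (rule ccontr)
    assume "y r \<notin> cball p \<epsilon>"
    then have "d r > \<epsilon>"
      by (simp add: d_def dist_commute)
    moreover have "continuous_on {0..r} d"
      using r st t by (intro contd) auto
    ultimately obtain q where "0 \<le> q" "q \<le> r" "d q = \<epsilon>"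
      using IVT'[of d 0 \<epsilon> r] y0 r by (auto simp: d_def)
    then have "q = r"
      using least[of q] r st by (auto simp: S_def)
    then show False
      using \<open>d q = \<epsilon>\<close> \<open>d r > \<epsilon>\<close> by simp
  qed
  have "((V \<circ> y) has_derivative (\<lambda>_. 0)) (at r within {0..s})" if "r \<in> {0..s}" for r
  proof -
    have sub: "{0..s} \<subseteq> {0..<T}"
      using st t by auto
    then have "(y has_vector_derivative f (y r)) (at r within {0..s})"
      using y that by (meson has_vector_derivative_within_subset solution_on_def subsetD)
    from vector_derivative_diff_chain_within[OF this has_derivative_at_withinI[OF dV]]
    show ?thesis
      using cons[OF inside[OF that]] by (simp add: has_vector_derivative_def)
  qed
  then have "(V \<circ> y) 0 = (V \<circ> y) s"
    by (rule has_derivative_zero_unique[rotated]) (use st in auto)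
  then show False
    using sphere[of "y s"] st by (simp add: d_def)
qed

text \<open>The minimum of \<open>V\<close> over a small sphere exceeds \<open>V p\<close>, and by
  continuity all starting points near \<open>p\<close> lie below it. The Lipschitz bound serves the
  existence of solutions.\<close>

theorem conserved_quantity_lyapunov_stable:
  fixes f :: "'a::euclidean_space \<Rightarrow> 'a" and V :: "'a \<Rightarrow> real"
  assumes dV: "\<And>x. (V has_derivative V' x) (at x)"
    and cons: "\<And>x. V' x (f x) = 0"
    and "r > 0" and strict: "\<And>x. x \<noteq> p \<Longrightarrow> dist x p \<le> r \<Longrightarrow> V p < V x"
    and lip: "L-lipschitz_on (cball p r) f"
  shows "lyapunov_stable f p"
  unfolding lyapunov_stable_def
proof (intro allI impI)
  fix \<epsilon>0 :: real assume "\<epsilon>0 > 0"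
  \<comment> \<open>Capping by \<open>r\<close> keeps the sphere in the region where
    \<open>V\<close> exceeds \<open>V p\<close> and the field is Lipschitz.\<close>
  define \<epsilon> where "\<epsilon> = min \<epsilon>0 r"
  have \<epsilon>: "\<epsilon> > 0" "\<epsilon> \<le> \<epsilon>0" "\<epsilon> \<le> r"
    using \<open>\<epsilon>0 > 0\<close> \<open>r > 0\<close> by (auto simp: \<epsilon>_def)
  have contV: "continuous_on S V" for S
    by (meson continuous_at_imp_continuous_on dV has_derivative_continuous)
  have "sphere p \<epsilon> \<noteq> {}"
    using \<epsilon> by simp
  then obtain w where w: "w \<in> sphere p \<epsilon>" and min: "\<And>x. x \<in> sphere p \<epsilon> \<Longrightarrow> V w \<le> V x"
    using continuous_attains_inf[of "sphere p \<epsilon>" V] contV by auto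
  have "V p < V w"
    using w \<epsilon> by (intro strict) (auto simp: dist_commute)
  moreover have "(V \<longlongrightarrow> V p) (nhds p)"
    using has_derivative_continuous[OF dV] by (simp add: continuous_at tendsto_at_iff_tendsto_nhds)
  ultimately have "\<forall>\<^sub>F x in nhds p. V x < V w"
    by (rule order_tendstoD(2)[rotated])
  then obtain \<delta>0 where \<delta>0: "\<delta>0 > 0" "\<And>x. dist x p < \<delta>0 \<Longrightarrow> V x < V w"
    by (auto simp: eventually_nhds_metric)
  define \<delta> where "\<delta> = min \<delta>0 \<epsilon>"
  \<comment> \<open>Stated for every \<open>g\<close> agreeing with \<open>f\<close> on the ball, to
    cover both \<open>f\<close> and the truncated field \<open>f \<circ> P\<close>.\<close>
  have confined: "dist (y t) p < \<epsilon>"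
    if "\<And>x. x \<in> cball p r \<Longrightarrow> g x = f x" "solution_on g y {0..<T}" "dist (y 0) p < \<delta>" "t \<in> {0..<T}"
    for g y T t
  proof (rule conserved_quantity_confines[OF dV _ _ that(2) _ that(4)])
    show "V' x (g x) = 0" if "x \<in> cball p \<epsilon>" for x
      using cons[of x] \<open>\<And>x. x \<in> cball p r \<Longrightarrow> g x = f x\<close>[of x] \<epsilon> that by auto
    show "V (y 0) < V x" if "dist x p = \<epsilon>" for x
      using \<delta>0(2)[of "y 0"] min[of x] that \<open>dist (y 0) p < \<delta>\<close> by (force simp: \<delta>_def dist_commute)
    show "dist (y 0) p < \<epsilon>"
      using that(3) by (simp add: \<delta>_def)
  qed
  show "\<exists>\<delta>>0. \<forall>x0. dist x0 p < \<delta> \<longrightarrow>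
        (\<exists>x. solution_on f x {0..} \<and> x 0 = x0) \<and>
        (\<forall>x T. T > 0 \<longrightarrow> solution_on f x {0..<T} \<longrightarrow> x 0 = x0 \<longrightarrow>
           (\<forall>t\<in>{0..<T}. dist (x t) p < \<epsilon>0))"
  proof (intro exI[of _ \<delta>] conjI allI impI ballI)
    show "\<delta> > 0"
      using \<delta>0 \<epsilon> by (simp add: \<delta>_def)
  next
    fix x0 assume x0: "dist x0 p < \<delta>"
    \<comment> \<open>The projection onto a closed convex set is 1-Lipschitz, so
      \<open>f \<circ> P\<close> has the constant \<open>L\<close> on the whole space.\<close>
    define P where "P = closest_point (cball p r)"
    have P: "P x \<in> cball p r" for x
      using \<open>r > 0\<close> unfolding P_def by (intro closest_point_in_set) auto
    have "L-lipschitz_on UNIV (f \<circ> P)"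
    proof (rule lipschitz_onI)
      fix x x'
      have "dist (f (P x)) (f (P x')) \<le> L * dist (P x) (P x')"
        using lipschitz_onD[OF lip P P] .
      also have "dist (P x) (P x') \<le> dist x x'"
        unfolding P_def using \<open>r > 0\<close> by (intro closest_point_lipschitz) auto
      finally show "dist ((f \<circ> P) x) ((f \<circ> P) x') \<le> L * dist x x'"
        using lipschitz_on_nonneg[OF lip] by (simp add: mult_left_mono)
    qed (rule lipschitz_on_nonneg[OF lip])
    then obtain y where y: "solution_on (f \<circ> P) y {0..}" "y 0 = x0"
      by (rule global_solution_exists)
    have agree: "(f \<circ> P) x = f x" if "x \<in> cball p r" for x
      using that by (simp add: P_def closest_point_self)
    have "y t \<in> cball p r" if "t \<ge> 0" for t
    proof -
      have "solution_on (f \<circ> P) y {0..<t + 1}"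
        using y(1) unfolding solution_on_def
        by (auto intro: has_vector_derivative_within_subset[of _ _ _ "{0..}"])
      then have "dist (y t) p < \<epsilon>"
        using agree x0 y(2) that by (intro confined[of "f \<circ> P" y "t + 1" t]) auto
      then show ?thesis
        using \<epsilon> by (simp add: dist_commute)
    qed
    then have "solution_on f y {0..}"
      using y(1) agree by (auto simp: solution_on_def)
    with y(2) show "\<exists>x. solution_on f x {0..} \<and> x 0 = x0"
      by blast
  next
    fix x0 x T t
    assume "dist x0 p < \<delta>" "solution_on f x {0..<T}" "x 0 = x0" "t \<in> {0..<T}"
    then show "dist (x t) p < \<epsilon>0"
      using confined[of f x T t] \<epsilon> by fastforce
  qed
qed

section \<open>Second-derivative test at a critical point\<close>

text \<open>Compactness of the unit sphere bounds the quadratic form below by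
  \<open>c * (norm v)\<^sup>2\<close>. The first-order expansion of \<open>g\<close> at
  \<open>p\<close> then gives the gradient a positive radial component nearby, so \<open>V\<close>
  increases along segments leaving \<open>p\<close>.\<close>

lemma strict_local_min_second_derivative:
  fixes V :: "'a::euclidean_space \<Rightarrow> real"
  assumes dV: "\<And>x. (V has_derivative (\<lambda>v. g x \<bullet> v)) (at x)"
    and dg: "(g has_derivative A) (at p)" and "g p = 0"
    and pos: "\<And>v. v \<noteq> 0 \<Longrightarrow> v \<bullet> A v > 0"
  obtains r where "r > 0" "\<And>x. x \<noteq> p \<Longrightarrow> dist x p \<le> r \<Longrightarrow> V p < V x"
proof -
  have linA: "bounded_linear A"
    using dg by (rule has_derivative_bounded_linear)
  interpret A: bounded_linear A by (rule linA)
  have "continuous_on (sphere 0 1) (\<lambda>v. v \<bullet> A v)"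
    by (intro continuous_intros A.continuous_on)
  moreover have "sphere (0::'a) 1 \<noteq> {}"
    by simp
  ultimately obtain w where w: "w \<in> sphere 0 1" and "\<And>v. v \<in> sphere 0 1 \<Longrightarrow> w \<bullet> A w \<le> v \<bullet> A v"
    using continuous_attains_inf[OF compact_sphere] by blast
  define c where "c = w \<bullet> A w"
  have min: "c \<le> v \<bullet> A v" if "norm v = 1" for v
    using \<open>\<And>v. v \<in> sphere 0 1 \<Longrightarrow> w \<bullet> A w \<le> v \<bullet> A v\<close> that by (simp add: c_def)
  have "w \<noteq> 0"
    using w by auto
  then have "c > 0"
    unfolding c_def by (rule pos)
  have lower: "c * (norm v)\<^sup>2 \<le> v \<bullet> A v" for v
  proof (cases "v = 0")
    case False
    then have "c \<le> (v /\<^sub>R norm v) \<bullet> A (v /\<^sub>R norm v)"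
      by (intro min) simp
    also have "\<dots> = (v \<bullet> A v) / (norm v)\<^sup>2"
      by (simp add: A.scaleR power2_eq_square field_simps)
    finally show ?thesis
      using False by (simp add: field_simps)
  qed simp
  \<comment> \<open>The tolerance \<open>c / 2\<close> costs only half of the quadratic lower
    bound.\<close>
  obtain d where "d > 0" and d: "\<And>y. norm (y - p) < d \<Longrightarrow>
      norm (g y - g p - A (y - p)) \<le> c / 2 * norm (y - p)"
    using dg \<open>c > 0\<close> unfolding has_derivative_at_alt by (meson half_gt_zero)
  have gpos: "(y - p) \<bullet> g y > 0" if "y \<noteq> p" "norm (y - p) < d" for y
  proof -
    have "\<bar>(y - p) \<bullet> (g y - A (y - p))\<bar> \<le> norm (y - p) * norm (g y - A (y - p))"
      by (rule Cauchy_Schwarz_ineq2)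
    also have "\<dots> \<le> norm (y - p) * (c / 2 * norm (y - p))"
      using d[OF that(2)] \<open>g p = 0\<close> by (intro mult_left_mono) auto
    also have "\<dots> = c / 2 * (norm (y - p))\<^sup>2"
      by (simp add: power2_eq_square)
    finally have "(y - p) \<bullet> g y \<ge> (y - p) \<bullet> A (y - p) - c / 2 * (norm (y - p))\<^sup>2"
      unfolding inner_diff_right by linarith
    moreover have "c * (norm (y - p))\<^sup>2 > 0"
      using \<open>c > 0\<close> that(1) by simp
    ultimately show ?thesis
      using lower[of "y - p"] by linarith
  qed
  \<comment> \<open>Halving \<open>d\<close> fits a closed ball into the open ball where
    \<open>gpos\<close> holds.\<close>
  show thesis
  proof (rule that[of "d / 2"])
    fix x assume x: "x \<noteq> p" "dist x p \<le> d / 2"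
    define \<phi> where "\<phi> s = V (p + s *\<^sub>R (x - p))" for s
    have d\<phi>: "(\<phi> has_real_derivative g (p + s *\<^sub>R (x - p)) \<bullet> (x - p)) (at s)" for s
    proof -
      have "(\<phi> has_derivative (\<lambda>h. g (p + s *\<^sub>R (x - p)) \<bullet> (h *\<^sub>R (x - p)))) (at s)"
        unfolding \<phi>_def
        by (rule has_derivative_compose[OF _ dV]) (auto intro!: derivative_eq_intros)
      then show ?thesis
        by (rule has_derivative_imp_has_field_derivative) simp
    qed
    \<comment> \<open>The derivative of \<open>\<phi>\<close> vanishes at 0 because
      \<open>g p = 0\<close>, so positivity is used on the open interval, where the factor
      \<open>s\<close> can be cancelled.\<close>
    have "\<phi> 0 < \<phi> 1"
    proof (rule DERIV_pos_imp_increasing_open[of 0 1 \<phi>])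
      fix s :: real assume s: "0 < s" "s < 1"
      have "norm (s *\<^sub>R (x - p)) \<le> norm (x - p)"
        using s by (simp add: mult_left_le_one_le)
      also have "\<dots> < d"
        using x \<open>d > 0\<close> by (simp add: dist_norm)
      finally have "(s *\<^sub>R (x - p)) \<bullet> g (p + s *\<^sub>R (x - p)) > 0"
        using gpos[of "p + s *\<^sub>R (x - p)"] x s by auto
      then show "\<exists>y. (\<phi> has_real_derivative y) (at s) \<and> y > 0"
        using d\<phi>[of s] s by (auto simp: inner_commute zero_less_mult_iff)
    next
      show "continuous_on {0..1} \<phi>"
        by (rule DERIV_continuous_on) (rule has_field_derivative_at_within[OF d\<phi>])
    qed simp
    then show "V p < V x"
      by (simp add: \<phi>_def)
  qed (use \<open>d > 0\<close> in auto)
qed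

section \<open>Polynomial maps are Lipschitz on bounded sets\<close>

text \<open>Boundedness of \<open>X\<close> enters in the product case: both factors must be bounded
  there, which follows from continuity on the compact closure.\<close>

lemma real_polynomial_function_lipschitz_on:
  fixes f :: "'a::euclidean_space \<Rightarrow> real"
  assumes "real_polynomial_function f" and X: "bounded X"
  shows "\<exists>L. L-lipschitz_on X f"
  using assms(1)
proof induction
  case (linear f)
  then obtain K where "K \<ge> 0" "\<And>x. norm (f x) \<le> norm x * K"
    using bounded_linear.nonneg_bounded by blast
  then have "K-lipschitz_on X f"
    by (intro lipschitz_onI)
       (simp_all add: dist_norm mult.commute flip: linear_diff[OF bounded_linear.linear[OF linear]])
  then show ?case ..
next
  case (const c)
  then show ?case using lipschitz_on_constant by blast
next
  case (add f g)
  then show ?case using lipschitz_on_add by blast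
next
  case (mult f g)
  then obtain L M where L: "L-lipschitz_on X f" and M: "M-lipschitz_on X g"
    by blast
  have bdd: "\<exists>b. \<forall>x\<in>X. \<bar>h x\<bar> \<le> b" if "real_polynomial_function h" for h :: "'a \<Rightarrow> real"
  proof -
    have "bounded (h ` closure X)"
      using X that
      by (intro compact_imp_bounded compact_continuous_image continuous_on_polymonial_function)
         (auto simp: compact_closure real_polynomial_function_eq)
    then show ?thesis
      by (meson bounded_real closure_subset image_eqI subsetD)
  qed
  obtain a b where a: "\<And>x. x \<in> X \<Longrightarrow> \<bar>f x\<bar> \<le> a" and b: "\<And>x. x \<in> X \<Longrightarrow> \<bar>g x\<bar> \<le> b"
    using bdd mult.hyps by meson
  \<comment> \<open>For empty \<open>X\<close> the bounds \<open>a\<close> and \<open>b\<close> may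
    be negative; absolute values keep the constant nonnegative.\<close>
  have "(\<bar>a\<bar> * M + L * \<bar>b\<bar>)-lipschitz_on X (\<lambda>x. f x * g x)"
  proof (rule lipschitz_onI)
    fix x y assume xy: "x \<in> X" "y \<in> X"
    have "dist (f x * g x) (f y * g y) = \<bar>f x * (g x - g y) + (f x - f y) * g y\<bar>"
      by (simp add: dist_real_def algebra_simps)
    also have "\<dots> \<le> \<bar>f x\<bar> * dist (g x) (g y) + dist (f x) (f y) * \<bar>g y\<bar>"
      by (metis abs_mult abs_triangle_ineq dist_real_def)
    also have "\<dots> \<le> \<bar>a\<bar> * (M * dist x y) + L * dist x y * \<bar>b\<bar>"
      using xy a[of x] b[of y] lipschitz_onD[OF L xy] lipschitz_onD[OF M xy]
        lipschitz_on_nonneg[OF L] lipschitz_on_nonneg[OF M]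
      by (intro add_mono mult_mono) auto
    finally show "dist (f x * g x) (f y * g y) \<le> (\<bar>a\<bar> * M + L * \<bar>b\<bar>) * dist x y"
      by (simp add: algebra_simps)
  qed (use lipschitz_on_nonneg[OF L] lipschitz_on_nonneg[OF M] in auto)
  then show ?case ..
qed

text \<open>The norm is at most the sum of the absolute coordinates, so the constants of the
  coordinate functions add up.\<close>

lemma polynomial_function_lipschitz_on:
  fixes f :: "'a::euclidean_space \<Rightarrow> 'b::euclidean_space"
  assumes f: "polynomial_function f" and X: "bounded X"
  shows "\<exists>L. L-lipschitz_on X f"
proof -
  have "\<forall>b. \<exists>L. L-lipschitz_on X (\<lambda>x. f x \<bullet> b)"
  proof
    fix b
    have "real_polynomial_function ((\<lambda>y. y \<bullet> b) \<circ> f)"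
      using f bounded_linear_inner_left unfolding polynomial_function_def by blast
    then show "\<exists>L. L-lipschitz_on X (\<lambda>x. f x \<bullet> b)"
      using real_polynomial_function_lipschitz_on[OF _ X] by (simp add: o_def)
  qed
  then obtain L where L: "\<And>b. (L b)-lipschitz_on X (\<lambda>x. f x \<bullet> b)"
    by metis
  have "(\<Sum>b\<in>Basis. L b)-lipschitz_on X f"
  proof (rule lipschitz_onI)
    fix x y assume xy: "x \<in> X" "y \<in> X"
    have "dist (f x) (f y) \<le> (\<Sum>b\<in>Basis. \<bar>(f x - f y) \<bullet> b\<bar>)"
      unfolding dist_norm by (rule norm_le_l1)
    also have "\<dots> \<le> (\<Sum>b\<in>Basis. L b * dist x y)"
      using lipschitz_onD[OF L xy] by (intro sum_mono) (simp add: dist_real_def inner_diff_left)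
    finally show "dist (f x) (f y) \<le> (\<Sum>b\<in>Basis. L b) * dist x y"
      by (simp add: sum_distrib_right)
  qed (use lipschitz_on_nonneg[OF L] in \<open>auto intro: sum_nonneg\<close>)
  then show ?thesis ..
qed

section \<open>Forms of supersymmetric tensors and their derivatives\<close>

text \<open>With multisets in place of permutations, fixing an index or exchanging two of them
  becomes rewriting.\<close>

lemma supersymmetric_iff_mset:
  "supersymmetric n A \<longleftrightarrow> (\<forall>js js'. length js = n \<longrightarrow> mset js' = mset js \<longrightarrow> A js' = A js)"
  unfolding supersymmetric_def by (metis mset_eq_permutation mset_permute_list)

lemma supersymmetric_Cons:
  assumes "supersymmetric (Suc n) A"
  shows "supersymmetric n (\<lambda>js. A (i # js))"
  using assms by (simp add: supersymmetric_iff_mset)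

lemma supersymmetric_swap:
  assumes "supersymmetric (Suc (Suc n)) A" "length js = n"
  shows "A (i # l # js) = A (l # i # js)"
  using assms(1)[unfolded supersymmetric_iff_mset, rule_format, of "l # i # js" "i # l # js"] assms(2)
  by (simp add: add_mset_commute)

text \<open>This is the homogeneous form $A x^n$, the degree-\<open>n\<close> part of a
  Hamiltonian.\<close>

definition tensor_form :: "nat \<Rightarrow> 'n::finite tensor \<Rightarrow> real ^ 'n \<Rightarrow> real" where
  "tensor_form n A x = (\<Sum>js | length js = n. A js * prod_list (map (\<lambda>j. x $ j) js))"

lemma tensor_form_0 [simp]: "tensor_form 0 A = (\<lambda>_. A [])"
  by (simp add: tensor_form_def fun_eq_iff)

text \<open>Splitting an index list into head and tail gives the recursion on which the inductions
  over the order rest.\<close>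

lemma tensor_form_Suc:
  "tensor_form (Suc n) A = (\<lambda>x. \<Sum>i\<in>UNIV. x $ i * tensor_form n (\<lambda>js. A (i # js)) x)"
proof
  fix x :: "real ^ 'a"
  have "bij_betw (\<lambda>(i, js). i # js) (UNIV \<times> {js. length js = n}) {js :: 'a list. length js = Suc n}"
    by (force simp: bij_betw_def inj_on_def length_Suc_conv image_iff)
  then have "tensor_form (Suc n) A x =
      (\<Sum>(i, js)\<in>UNIV \<times> {js. length js = n}. A (i # js) * (x $ i * prod_list (map (\<lambda>j. x $ j) js)))"
    unfolding tensor_form_def by (subst sum.reindex_bij_betw[symmetric]) (auto intro: sum.cong)
  also have "\<dots> = (\<Sum>i\<in>UNIV. \<Sum>js | length js = n. A (i # js) * (x $ i * prod_list (map (\<lambda>j. x $ j) js)))"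
    by (rule sum.cartesian_product[symmetric])
  finally show "tensor_form (Suc n) A x = (\<Sum>i\<in>UNIV. x $ i * tensor_form n (\<lambda>js. A (i # js)) x)"
    by (simp add: tensor_form_def sum_distrib_left mult_ac)
qed

lemma tensor_form_cong:
  "(\<And>js. length js = n \<Longrightarrow> A js = A' js) \<Longrightarrow> tensor_form n A x = tensor_form n A' x"
  by (simp add: tensor_form_def)

lemma real_polynomial_function_tensor_form: "real_polynomial_function (tensor_form n A)"
proof (induction n arbitrary: A)
  case (Suc n)
  then show ?case
    unfolding tensor_form_Suc
    by (intro real_polynomial_function_sum real_polynomial_function.intros(4)
        real_polynomial_function.intros(1)[OF bounded_linear_vec_nth]) auto
qed (simp add: real_polynomial_function.intros(2))

text \<open>The product rule on the head-tail recursion gives one copy of the sum; by induction and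
  symmetry in the first two indices, the derivatives of the slices contribute the remaining
  copies.\<close>

lemma has_derivative_tensor_form:
  assumes "supersymmetric n A"
  shows "(tensor_form n A has_derivative
    (\<lambda>v. real n * (\<Sum>i\<in>UNIV. v $ i * tensor_form (n - 1) (\<lambda>js. A (i # js)) x))) (at x)"
  using assms
proof (induction n arbitrary: A)
  case (Suc n)
  define D where "D l v = (\<Sum>i\<in>UNIV. v $ i * tensor_form (n - 1) (\<lambda>js. A (l # i # js)) x)" for l v
  have IH: "(tensor_form n (\<lambda>js. A (l # js)) has_derivative (\<lambda>v. real n * D l v)) (at x)" for l
    unfolding D_def using Suc.IH[OF supersymmetric_Cons[OF Suc.prems]] .
  \<comment> \<open>Both sides vanish for \<open>n = 0\<close>. Otherwise the double sum is
    reordered and the indices \<open>l\<close> and \<open>i\<close> are exchanged by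
    supersymmetry.\<close>
  have sym: "real n * (\<Sum>l\<in>UNIV. x $ l * D l v)
      = real n * (\<Sum>i\<in>UNIV. v $ i * tensor_form n (\<lambda>js. A (i # js)) x)" for v
  proof (cases n)
    case n: (Suc m)
    have swap: "tensor_form m (\<lambda>js. A (l # i # js)) x = tensor_form m (\<lambda>js. A (i # l # js)) x" for i l
      using Suc.prems unfolding n by (intro tensor_form_cong supersymmetric_swap)
    have "(\<Sum>l\<in>UNIV. x $ l * D l v)
        = (\<Sum>l\<in>UNIV. \<Sum>i\<in>UNIV. v $ i * (x $ l * tensor_form m (\<lambda>js. A (l # i # js)) x))"
      by (simp add: D_def n sum_distrib_left mult_ac)
    also have "\<dots> = (\<Sum>i\<in>UNIV. \<Sum>l\<in>UNIV. v $ i * (x $ l * tensor_form m (\<lambda>js. A (l # i # js)) x))"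
      by (rule sum.swap)
    also have "\<dots> = (\<Sum>i\<in>UNIV. \<Sum>l\<in>UNIV. v $ i * (x $ l * tensor_form m (\<lambda>js. A (i # l # js)) x))"
      by (subst swap) (rule refl)
    also have "\<dots> = (\<Sum>i\<in>UNIV. v $ i * tensor_form n (\<lambda>js. A (i # js)) x)"
      by (simp add: n tensor_form_Suc sum_distrib_left)
    finally show ?thesis by simp
  qed simp
  have "(tensor_form (Suc n) A has_derivative
      (\<lambda>v. \<Sum>l\<in>UNIV. x $ l * (real n * D l v) + v $ l * tensor_form n (\<lambda>js. A (l # js)) x)) (at x)"
    unfolding tensor_form_Suc
    by (intro has_derivative_sum has_derivative_mult IH bounded_linear_imp_has_derivative bounded_linear_vec_nth)
  also have "(\<lambda>v. \<Sum>l\<in>UNIV. x $ l * (real n * D l v) + v $ l * tensor_form n (\<lambda>js. A (l # js)) x)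
      = (\<lambda>v. real (Suc n) * (\<Sum>i\<in>UNIV. v $ i * tensor_form (Suc n - 1) (\<lambda>js. A (i # js)) x))"
    using sym by (simp add: fun_eq_iff sum.distrib sum_distrib_left algebra_simps)
  finally show ?case .
qed simp

lemma has_derivative_tensor_form_gradient:
  assumes "supersymmetric n A"
  shows "(tensor_form n A has_derivative (\<lambda>v. (real n *\<^sub>R tensor_vec n A x) \<bullet> v)) (at x)"
proof -
  have "(\<lambda>v. (real n *\<^sub>R tensor_vec n A x) \<bullet> v)
      = (\<lambda>v. real n * (\<Sum>i\<in>UNIV. v $ i * tensor_form (n - 1) (\<lambda>js. A (i # js)) x))"
    by (simp add: fun_eq_iff tensor_vec_def tensor_form_def inner_vec_def sum_distrib_left mult_ac)
  then show ?thesis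
    using has_derivative_tensor_form[OF assms] by simp
qed

lemma has_derivative_vec_lambda:
  fixes f :: "'a::real_normed_vector \<Rightarrow> real ^ 'n"
  assumes "\<And>i. ((\<lambda>x. f x $ i) has_derivative (\<lambda>v. f' v $ i)) (at x within S)"
  shows "(f has_derivative f') (at x within S)"
  using assms unfolding has_derivative_componentwise_within[of f]
  by (auto simp: Basis_vec_def inner_axis)

text \<open>For positive order, each component is the form of a slice with fixed first index, which
  is again supersymmetric, so the derivative formula for forms applies to it.\<close>

lemma has_derivative_tensor_vec:
  assumes A: "supersymmetric n A"
  shows "(tensor_vec n A has_derivative (\<lambda>v. (real (n - 1) *\<^sub>R tensor_mat n A x) *v v)) (at x)"
proof (cases n)
  case 0
  \<comment> \<open>Truncated subtraction \<open>0 - 1 = 0\<close> makes the map constant and the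
    factor of its derivative zero.\<close>
  then have "tensor_vec n A = (\<lambda>_. \<chi> i. A [i])"
    by (simp add: tensor_vec_def fun_eq_iff)
  then show ?thesis
    using 0 by simp
next
  case (Suc m)
  show ?thesis
  proof (rule has_derivative_vec_lambda)
    fix i
    have "((\<lambda>x. tensor_form m (\<lambda>js. A (i # js)) x) has_derivative
        (\<lambda>v. real m * (\<Sum>l\<in>UNIV. v $ l * tensor_form (m - 1) (\<lambda>js. A (i # l # js)) x))) (at x)"
      using has_derivative_tensor_form[OF supersymmetric_Cons[OF A[unfolded Suc]]] .
    also have "(\<lambda>x. tensor_form m (\<lambda>js. A (i # js)) x) = (\<lambda>x. tensor_vec n A x $ i)"
      by (simp add: Suc tensor_vec_def tensor_form_def)
    also have "(\<lambda>v. real m * (\<Sum>l\<in>UNIV. v $ l * tensor_form (m - 1) (\<lambda>js. A (i # l # js)) x))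
        = (\<lambda>v. ((real (n - 1) *\<^sub>R tensor_mat n A x) *v v) $ i)"
      by (simp add: fun_eq_iff Suc tensor_mat_def tensor_form_def matrix_vector_mult_def
          sum_distrib_left mult_ac)
    finally show "((\<lambda>x. tensor_vec n A x $ i) has_derivative
        (\<lambda>v. ((real (n - 1) *\<^sub>R tensor_mat n A x) *v v) $ i)) (at x)" .
  qed
qed

lemma polynomial_function_vec_lambda:
  fixes f :: "'a::real_normed_vector \<Rightarrow> real ^ 'n"
  assumes "\<And>i. real_polynomial_function (\<lambda>x. f x $ i)"
  shows "polynomial_function f"
proof -
  have "polynomial_function (\<lambda>x. \<Sum>i\<in>UNIV. f x $ i *\<^sub>R (axis i 1 :: real ^ 'n))"
    using assms
    by (intro polynomial_function_sum polynomial_function_mult polynomial_function_const)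
       (auto simp: real_polynomial_function_eq)
  also have "(\<lambda>x. \<Sum>i\<in>UNIV. f x $ i *\<^sub>R (axis i 1 :: real ^ 'n)) = f"
    by (simp add: basis_expansion flip: scalar_mult_eq_scaleR)
  finally show ?thesis .
qed

lemma polynomial_function_tensor_vec: "polynomial_function (tensor_vec n A)"
proof (rule polynomial_function_vec_lambda)
  fix i
  have "(\<lambda>x. tensor_vec n A x $ i) = tensor_form (n - 1) (\<lambda>js. A (i # js))"
    by (simp add: fun_eq_iff tensor_vec_def tensor_form_def)
  then show "real_polynomial_function (\<lambda>x. tensor_vec n A x $ i)"
    by (simp add: real_polynomial_function_tensor_form)
qed

text \<open>\<open>R\<close> acts on the first index, the one left free by the contraction with
  \<open>x\<close>.\<close>

lemma tensor_vec_matrix_tensor: "tensor_vec n (matrix_tensor R A) x = R *v tensor_vec n A x"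
proof -
  have "(\<Sum>js | length js = n - 1. (\<Sum>j\<in>UNIV. R $ i $ j * A (j # js)) * prod_list (map (\<lambda>j. x $ j) js))
      = (\<Sum>j\<in>UNIV. R $ i $ j * (\<Sum>js | length js = n - 1. A (j # js) * prod_list (map (\<lambda>j. x $ j) js)))" for i
    unfolding sum_distrib_right sum_distrib_left
    by (subst sum.swap) (simp add: mult.assoc)
  then show ?thesis
    by (simp add: vec_eq_iff tensor_vec_def matrix_tensor_def matrix_vector_mult_def)
qed

section \<open>The symplectic matrix and the Hamiltonian field\<close>

lemma symplectic_J_mult:
  "(symplectic_J *v v) $ Inl a = v $ Inr a" "(symplectic_J *v v) $ Inr a = - v $ Inl a"
  by (auto simp: matrix_vector_mult_def symplectic_J_def sum.Plus if_distrib[of "\<lambda>c. c * _"]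
      cong: if_cong simp flip: UNIV_Plus_UNIV)

text \<open>The contributions of the two halves cancel by skew-symmetry; this is the source of
  energy conservation.\<close>

lemma inner_symplectic_J [simp]: "v \<bullet> (symplectic_J *v v) = 0"
  by (simp add: inner_vec_def sum.Plus symplectic_J_mult sum_negf mult.commute
      flip: UNIV_Plus_UNIV)

text \<open>Nondegeneracy identifies the equilibria with the zeros of the gradient.\<close>

lemma symplectic_J_eq_0_iff: "symplectic_J *v v = 0 \<longleftrightarrow> v = 0"
proof
  assume "symplectic_J *v v = 0"
  then have "v $ Inl a = 0" "v $ Inr a = 0" for a
    using symplectic_J_mult[of v a] by auto
  then show "v = 0"
    by (metis vec_eq_iff zero_index sum.exhaust)
qed simp

text \<open>For supersymmetric \<open>B j\<close> this is the gradient of the sum of the forms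
  \<open>tensor_form j (B j)\<close>.\<close>

definition hamiltonian_gradient ::
  "nat \<Rightarrow> (nat \<Rightarrow> 'n::finite tensor) \<Rightarrow> real ^ 'n \<Rightarrow> real ^ 'n" where
  "hamiltonian_gradient k B x = (\<Sum>j = 2..k. real j *\<^sub>R tensor_vec j (B j) x)"

lemma hamiltonian_field_eq: "hamiltonian_field k B x = symplectic_J *v hamiltonian_gradient k B x"
  by (simp add: hamiltonian_field_def hamiltonian_gradient_def tensor_vec_matrix_tensor
      linear_sum[OF matrix_vector_mul_linear] matrix_vector_mult_scaleR)

lemma polynomial_function_hamiltonian_field: "polynomial_function (hamiltonian_field k B)"
  unfolding hamiltonian_field_def
  by (intro polynomial_function_sum polynomial_function_cmul polynomial_function_tensor_vec) auto

lemma matrix_vector_mult_sum_left: "(\<Sum>i\<in>I. M i) *v v = (\<Sum>i\<in>I. M i *v v)"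
  by (induction I rule: infinite_finite_induct) (auto simp: matrix_vector_mult_add_rdistrib)

theorem theorem4:
  fixes k :: nat
    and B :: "nat \<Rightarrow> ('m::finite + 'm) tensor"
    and xstar :: "real ^ ('m + 'm)"
  assumes "k \<ge> 2"
    and "\<And>j. 2 \<le> j \<Longrightarrow> j \<le> k \<Longrightarrow> supersymmetric j (B j)"
    and "xstar \<noteq> 0"
    and "equilibrium (hamiltonian_field k B) xstar"
    and "positive_definite (\<Sum>j = 2..k. (real j * (real j - 1)) *\<^sub>R tensor_mat j (B j) xstar) \<or>
         negative_definite (\<Sum>j = 2..k. (real j * (real j - 1)) *\<^sub>R tensor_mat j (B j) xstar)"
  shows "lyapunov_stable (hamiltonian_field k B) xstar"
proof -
  define M where "M = (\<Sum>j = 2..k. (real j * (real j - 1)) *\<^sub>R tensor_mat j (B j) xstar)"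
  define H where "H x = (\<Sum>j = 2..k. tensor_form j (B j) x)" for x
  let ?g = "hamiltonian_gradient k B"
  \<comment> \<open>The sign \<open>\<sigma>\<close>, chosen as 1 or -1, treats both definite cases
    at once, with \<open>\<sigma> * H\<close> as the conserved quantity.\<close>
  obtain \<sigma> :: real where \<sigma>: "\<And>v. v \<noteq> 0 \<Longrightarrow> v \<bullet> (\<sigma> *\<^sub>R (M *v v)) > 0"
  proof (cases "positive_definite M")
    case True
    then show thesis by (intro that[of 1]) (simp add: positive_definite_def)
  next
    case False
    then have "negative_definite M" using assms(5) by (simp add: M_def)
    then show thesis by (intro that[of "- 1"]) (simp add: negative_definite_def)
  qed
  have dH: "((\<lambda>x. \<sigma> * H x) has_derivative (\<lambda>v. (\<sigma> *\<^sub>R ?g x) \<bullet> v)) (at x)" for x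
  proof -
    have "(H has_derivative (\<lambda>v. \<Sum>j = 2..k. (real j *\<^sub>R tensor_vec j (B j) x) \<bullet> v)) (at x)"
      unfolding H_def using assms(2)
      by (intro has_derivative_sum has_derivative_tensor_form_gradient) auto
    from has_derivative_mult_right[OF this, of \<sigma>] show ?thesis
      by (simp add: hamiltonian_gradient_def inner_sum_left)
  qed
  have dg: "((\<lambda>x. \<sigma> *\<^sub>R ?g x) has_derivative (\<lambda>v. \<sigma> *\<^sub>R (M *v v))) (at xstar)"
  proof -
    have "(?g has_derivative
        (\<lambda>v. \<Sum>j = 2..k. real j *\<^sub>R ((real (j - 1) *\<^sub>R tensor_mat j (B j) xstar) *v v))) (at xstar)"
      unfolding hamiltonian_gradient_def using assms(2)
      by (intro has_derivative_sum has_derivative_scaleR_right has_derivative_tensor_vec) auto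
    \<comment> \<open>Since \<open>j \<ge> 2\<close>, \<open>real (j - 1)\<close> equals
      \<open>real j - 1\<close>, so the Jacobian of the gradient is the displayed matrix.\<close>
    also have "(\<lambda>v. \<Sum>j = 2..k. real j *\<^sub>R ((real (j - 1) *\<^sub>R tensor_mat j (B j) xstar) *v v)) = (*v) M"
      by (auto simp: fun_eq_iff M_def matrix_vector_mult_sum_left scaleR_matrix_vector_assoc of_nat_diff
          intro!: sum.cong)
    finally show ?thesis by (rule has_derivative_scaleR_right)
  qed
  have "?g xstar = 0"
    using assms(4) by (simp add: equilibrium_def hamiltonian_field_eq symplectic_J_eq_0_iff)
  then obtain r where r: "r > 0" "\<And>x. x \<noteq> xstar \<Longrightarrow> dist x xstar \<le> r \<Longrightarrow> \<sigma> * H xstar < \<sigma> * H x"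
    using strict_local_min_second_derivative[OF dH dg] \<sigma> by auto
  obtain L where L: "L-lipschitz_on (cball xstar r) (hamiltonian_field k B)"
    using polynomial_function_lipschitz_on[OF polynomial_function_hamiltonian_field] bounded_cball by blast
  \<comment> \<open>The conservation condition holds because the gradient is orthogonal to its image
    under \<open>symplectic_J\<close>.\<close>
  show ?thesis
    by (rule conserved_quantity_lyapunov_stable[OF dH _ r L]) (simp add: hamiltonian_field_eq)
qed

end
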